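(* Let $f,n:\mathbb{Z}_N\to\mathbb{C}$. Assume that the $n(x)$, $x\in\mathbb{Z}_N$, are independent circular complex Gaussian variables with variance $\sigma^2$, and fix $\gamma\in(0,1)$. With probability at least $1-\gamma$, $$\left|\mathrm{FR}(f+n)-\mathrm{FR}(f)\right|\le\frac{\left(\mathrm{FR}(n)+\mathrm{FR}(f)\right)\,t_\gamma}{\|\widehat f\|_2-t_\gamma},$$ where $$t_\gamma=\sigma\left(\sqrt N+\sqrt{\log(1/\gamma)}\right).$$
   Context: $N$ is a positive integer and $\mathbb{Z}_N=\mathbb{Z}/N\mathbb{Z}$. For $g:\mathbb{Z}_N\to\mathbb{C}$ the unitary Fourier transform is $\widehat g(m)=N^{-1/2}\sum_{x\in\mathbb{Z}_N}e^{-2\pi i xm/N}g(x)$, and $\|g\|_p=\left(\sum_{x\in\mathbb{Z}_N}|g(x)|^p\right)^{1/p}$. The Fourier ratio of $g$ is $\mathrm{FR}(g)=\|\widehat g\|_1/\|\widehat g\|_2$ (defined for $g$ not identically zero). A circular complex Gaussian variable with variance $\sigma^2$ is a complex random variable whose real and imaginary parts are independent $\mathcal{N}(0,\sigma^2/2)$ variables. $\log$ is the natural logarithm.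
   Formalization: The formal theorem assumes t_γ < ‖f̂‖₂ and σ > 0: for t_γ > ‖f̂‖₂ the right side is almost surely negative and the claim fails (e.g. N=1, f(0)=1, σ=2), for equality it is undefined, and for σ=0 FR(n) is undefined. *)

theory Defs
  imports "HOL-Probability.Probability" "HOL-Number_Theory.Residues"
begin

text \<open>
  A function on the integers modulo \<open>N\<close> is given by its values on the canonical representatives
  \<open>0, \<dots>, N - 1\<close>, that is, on the carrier of the residue ring; values elsewhere are never used.
\<close>

definition ZN :: "nat \<Rightarrow> int set" where
  "ZN N = carrier (residue_ring (int N))"

definition fourier :: "nat \<Rightarrow> (int \<Rightarrow> complex) \<Rightarrow> int \<Rightarrow> complex" where
  "fourier N g m =
     (1 / complex_of_real (sqrt (real N))) *
     (\<Sum>x\<in>ZN N. exp (- 2 * complex_of_real pi * \<i> * of_int (x * m) / of_nat N) * g x)"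

definition lnorm :: "nat \<Rightarrow> real \<Rightarrow> (int \<Rightarrow> complex) \<Rightarrow> real" where
  "lnorm N p g = (\<Sum>x\<in>ZN N. cmod (g x) powr p) powr (1 / p)"

text \<open>For \<open>g\<close> vanishing on all of \<open>ZN N\<close>, where the ratio is undefined, this gives \<open>0\<close>.\<close>

definition FR :: "nat \<Rightarrow> (int \<Rightarrow> complex) \<Rightarrow> real" where
  "FR N g = lnorm N 1 (fourier N g) / lnorm N 2 (fourier N g)"

text \<open>
  The parameter \<open>v\<close> is the total variance, so that the real and imaginary parts have variance
  \<open>v / 2\<close> each; \<^const>\<open>normal_density\<close> takes the standard deviation as its second argument.
  Only \<open>v > 0\<close> is meaningful.
\<close>

definition circular_complex_gaussian :: "'a measure \<Rightarrow> real \<Rightarrow> ('a \<Rightarrow> complex) \<Rightarrow> bool" where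
  "circular_complex_gaussian M v Z \<longleftrightarrow>
     prob_space.indep_var M borel (\<lambda>\<omega>. Re (Z \<omega>)) borel (\<lambda>\<omega>. Im (Z \<omega>)) \<and>
     distributed M lborel (\<lambda>\<omega>. Re (Z \<omega>)) (\<lambda>x. ennreal (normal_density 0 (sqrt (v / 2)) x)) \<and>
     distributed M lborel (\<lambda>\<omega>. Im (Z \<omega>)) (\<lambda>x. ennreal (normal_density 0 (sqrt (v / 2)) x))"

definition noise_bound :: "nat \<Rightarrow> real \<Rightarrow> real \<Rightarrow> real" where
  "noise_bound N \<sigma> \<gamma> = \<sigma> * (sqrt (real N) + sqrt (ln (1 / \<gamma>)))"

end

theory Submission
  imports Defs
begin

text \<open>
  With \<open>F\<close> and \<open>E\<close> the transforms of \<open>f\<close> and of the noise,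
  the triangle inequality for both norms gives
  \<open>\<bar>FR (f + n) - FR f\<bar> \<le> (\<parallel>E\<parallel>\<^sub>1 + FR f * \<parallel>E\<parallel>\<^sub>2) / (\<parallel>F\<parallel>\<^sub>2 - \<parallel>E\<parallel>\<^sub>2)\<close>, which is the claimed bound as soon as
  \<open>\<parallel>E\<parallel>\<^sub>2 \<le> t\<close>. By Plancherel \<open>\<parallel>E\<parallel>\<^sub>2 = \<parallel>n\<parallel>\<^sub>2\<close>, and \<open>\<parallel>n\<parallel>\<^sub>2\<^sup>2 / \<sigma>\<^sup>2\<close> is a sum of \<open>N\<close> independent variables
  with moment generating function \<open>1 / (1 - s)\<close>. Writing \<open>a = sqrt N\<close> and \<open>b = sqrt (ln (1 / \<gamma>))\<close>,
  the Chernoff bound at \<open>s = b / (a + b)\<close> together with \<open>ln (1 + b / a) \<le> b / a\<close> gives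
  the tail probability \<open>exp (- b\<^sup>2) = \<gamma>\<close>.
\<close>

section \<open>The norms on the residues modulo \<open>N\<close>\<close>

lemma ZN_eq: "ZN N = {0..<int N}"
  by (auto simp: ZN_def residue_ring_def)

lemma finite_ZN [simp]: "finite (ZN N)"
  by (simp add: ZN_eq)

lemma card_ZN [simp]: "card (ZN N) = N"
  by (simp add: ZN_eq)

lemma lnorm_1: "lnorm N 1 g = (\<Sum>x\<in>ZN N. cmod (g x))"
  by (simp add: lnorm_def sum_nonneg)

lemma lnorm_2: "lnorm N 2 g = L2_set (\<lambda>x. cmod (g x)) (ZN N)"
  by (simp add: lnorm_def L2_set_def powr_half_sqrt sum_nonneg)

lemma lnorm_nonneg: "0 \<le> lnorm N p g"
  by (simp add: lnorm_def)

lemma lnorm_1_triangle: "lnorm N 1 (\<lambda>x. g x + h x) \<le> lnorm N 1 g + lnorm N 1 h"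
  unfolding lnorm_1 sum.distrib[symmetric] by (intro sum_mono norm_triangle_ineq)

lemma lnorm_2_triangle: "lnorm N 2 (\<lambda>x. g x + h x) \<le> lnorm N 2 g + lnorm N 2 h"
  unfolding lnorm_2
  by (rule order_trans[OF L2_set_mono L2_set_triangle_ineq]) (auto intro: norm_triangle_ineq)

lemma lnorm_minus: "lnorm N p (\<lambda>x. - g x) = lnorm N p g"
  by (simp add: lnorm_def)

lemma abs_lnorm_1_diff_le: "\<bar>lnorm N 1 (\<lambda>x. g x + h x) - lnorm N 1 g\<bar> \<le> lnorm N 1 h"
  using lnorm_1_triangle[of N g h] lnorm_1_triangle[of N "\<lambda>x. g x + h x" "\<lambda>x. - h x"]
  by (simp add: lnorm_minus)

lemma abs_lnorm_2_diff_le: "\<bar>lnorm N 2 (\<lambda>x. g x + h x) - lnorm N 2 g\<bar> \<le> lnorm N 2 h"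
  using lnorm_2_triangle[of N g h] lnorm_2_triangle[of N "\<lambda>x. g x + h x" "\<lambda>x. - h x"]
  by (simp add: lnorm_minus)

lemma lnorm_2_eq_0_imp_lnorm_1_eq_0: "lnorm N 2 g = 0 \<Longrightarrow> lnorm N 1 g = 0"
  by (simp add: lnorm_1 lnorm_2 L2_set_eq_0_iff)

text \<open>Clearing the denominator is also legitimate for a vanishing transform: \<open>FR\<close>
  is then 0 and both norms are 0. So neither the signal nor the noise has to be assumed nonzero
  here.\<close>

lemma lnorm_1_fourier: "lnorm N 1 (fourier N g) = FR N g * lnorm N 2 (fourier N g)"
  by (simp add: FR_def lnorm_2_eq_0_imp_lnorm_1_eq_0)

lemma FR_nonneg: "0 \<le> FR N g"
  by (simp add: FR_def lnorm_nonneg)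

section \<open>Fourier transform and Plancherel\<close>

lemma fourier_add: "fourier N (\<lambda>x. g x + h x) = (\<lambda>m. fourier N g m + fourier N h m)"
  by (simp add: fourier_def fun_eq_iff distrib_left sum.distrib)

lemma fourier_cis:
  "fourier N g m =
     (\<Sum>x\<in>ZN N. cis (- (2 * pi * real_of_int (x * m) / real N)) * g x) / complex_of_real (sqrt (real N))"
proof -
  have "exp (- 2 * complex_of_real pi * \<i> * of_int (x * m) / of_nat N)
      = cis (- (2 * pi * real_of_int (x * m) / real N))" for x
    unfolding cis_conv_exp by (rule arg_cong[where f = exp]) simp
  then show ?thesis
    by (simp add: fourier_def)
qed

text \<open>A geometric sum over the powers of an \<open>N\<close>-th root of unity. The range of
  \<open>k\<close> is exactly that of a difference of two representatives in \<open>ZN N\<close>,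
  and 0 is its only multiple of \<open>N\<close>.\<close>

lemma sum_cis_ZN:
  assumes "\<bar>k\<bar> < int N"
  shows "(\<Sum>m\<in>ZN N. cis (- (2 * pi * real_of_int (k * m) / real N))) = (if k = 0 then of_nat N else 0)"
proof (cases "k = 0")
  case False
  with assms have N: "N > 0" by auto
  define w where "w = cis (- (2 * pi * real_of_int k / real N))"
  have "w \<noteq> 1"
  proof
    assume "w = 1"
    \<comment> \<open>An angle that is a multiple of \<open>2 * pi\<close> would make
      \<open>N\<close> divide \<open>k\<close>, impossible for 0 < |k| < N.\<close>
    then obtain j :: int where "- (2 * pi * real_of_int k / real N) = of_int (2 * j) * pi"
      by (auto simp: w_def cis_conv_exp exp_eq_1)
    then have "pi * real_of_int (- k) = pi * real_of_int (j * int N)"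
      using N by (simp add: field_simps)
    then have "- k = j * int N"
      by (metis mult_cancel_left of_int_eq_iff pi_neq_zero)
    then have "int N dvd k"
      by (metis dvd_minus_iff dvd_triv_right)
    then show False
      using False assms by (auto dest: dvd_imp_le_int)
  qed
  have "w ^ N = cis (2 * pi * real_of_int (- k))"
    using N by (simp add: w_def Complex.DeMoivre)
  also have "\<dots> = 1"
    by (rule cis_multiple_2pi) auto
  finally have wN: "w ^ N = 1" .
  have "(\<Sum>m\<in>ZN N. cis (- (2 * pi * real_of_int (k * m) / real N)))
      = (\<Sum>i<N. cis (- (2 * pi * real_of_int (k * int i) / real N)))"
    by (rule sum.reindex_bij_witness[where i = int and j = nat]) (auto simp: ZN_eq)
  also have "\<dots> = (\<Sum>i<N. w ^ i)"
    by (simp add: w_def Complex.DeMoivre algebra_simps)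
  also have "\<dots> = 0"
    using \<open>w \<noteq> 1\<close> wN by (simp add: sum_gp_strict)
  finally show ?thesis
    using False by simp
qed simp

text \<open>Expand each squared modulus as a double sum over \<open>x\<close> and \<open>y\<close>,
  move the sum over \<open>m\<close> innermost, and let orthogonality of characters leave only the
  diagonal. The computation is done in the complex numbers and pulled back to the reals at the
  end.\<close>

lemma plancherel:
  assumes "N > 0"
  shows "lnorm N 2 (fourier N g) = lnorm N 2 g"
proof -
  define e where "e k = cis (- (2 * pi * real_of_int k / real N))" for k :: int
  have e: "e (x * m) * cnj (e (y * m)) = e ((x - y) * m)" for x y m
    by (simp add: e_def cis_cnj cis_mult algebra_simps diff_divide_distrib)
  have F: "fourier N g m = (\<Sum>x\<in>ZN N. e (x * m) * g x) / complex_of_real (sqrt (real N))" for m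
    unfolding e_def by (rule fourier_cis)
  have orth: "(\<Sum>m\<in>ZN N. e ((x - y) * m)) = (if x = y then of_nat N else 0)"
    if "x \<in> ZN N" "y \<in> ZN N" for x y
    unfolding e_def using that by (subst sum_cis_ZN) (auto simp: ZN_eq)
  have sq: "complex_of_real (sqrt (real N)) * complex_of_real (sqrt (real N)) = of_nat N"
    by (metis of_real_mult of_real_of_nat_eq of_nat_0_le_iff real_sqrt_mult_self abs_of_nonneg)
  have "(\<Sum>m\<in>ZN N. complex_of_real ((cmod (fourier N g m))\<^sup>2))
      = (\<Sum>m\<in>ZN N. (\<Sum>x\<in>ZN N. \<Sum>y\<in>ZN N. g x * cnj (g y) * e ((x - y) * m)) / of_nat N)"
  proof (intro sum.cong refl)
    fix m
    have "complex_of_real ((cmod (fourier N g m))\<^sup>2)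
        = (\<Sum>x\<in>ZN N. \<Sum>y\<in>ZN N. (e (x * m) * g x) * cnj (e (y * m) * g y)) / of_nat N"
      by (simp add: complex_norm_square F sum_product sq del: of_real_power)
    also have "(\<lambda>x y. (e (x * m) * g x) * cnj (e (y * m) * g y))
        = (\<lambda>x y. g x * cnj (g y) * e ((x - y) * m))"
      unfolding e[symmetric] by (simp add: fun_eq_iff)
    finally show "complex_of_real ((cmod (fourier N g m))\<^sup>2)
        = (\<Sum>x\<in>ZN N. \<Sum>y\<in>ZN N. g x * cnj (g y) * e ((x - y) * m)) / of_nat N" .
  qed
  also have "\<dots> = (\<Sum>m\<in>ZN N. \<Sum>x\<in>ZN N. \<Sum>y\<in>ZN N. g x * cnj (g y) * e ((x - y) * m)) / of_nat N"
    by (simp add: sum_divide_distrib)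
  also have "(\<Sum>m\<in>ZN N. \<Sum>x\<in>ZN N. \<Sum>y\<in>ZN N. g x * cnj (g y) * e ((x - y) * m))
      = (\<Sum>x\<in>ZN N. \<Sum>m\<in>ZN N. \<Sum>y\<in>ZN N. g x * cnj (g y) * e ((x - y) * m))"
    by (rule sum.swap)
  also have "\<dots> = (\<Sum>x\<in>ZN N. \<Sum>y\<in>ZN N. \<Sum>m\<in>ZN N. g x * cnj (g y) * e ((x - y) * m))"
    by (intro sum.cong refl sum.swap)
  also have "\<dots> = (\<Sum>x\<in>ZN N. \<Sum>y\<in>ZN N. if x = y then g x * cnj (g y) * of_nat N else 0)"
    by (intro sum.cong refl) (simp add: sum_distrib_left[symmetric] orth)
  also have "\<dots> = (\<Sum>x\<in>ZN N. complex_of_real ((cmod (g x))\<^sup>2)) * of_nat N"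
    by (simp add: complex_norm_square sum_distrib_right del: of_real_power)
  finally have "complex_of_real (\<Sum>m\<in>ZN N. (cmod (fourier N g m))\<^sup>2)
      = complex_of_real (\<Sum>x\<in>ZN N. (cmod (g x))\<^sup>2)"
    using assms by simp
  then show ?thesis
    unfolding lnorm_2 L2_set_def of_real_eq_iff by simp
qed

section \<open>Deterministic perturbation of the Fourier ratio\<close>

lemma FR_perturbation:
  assumes "lnorm N 2 (fourier N h) \<le> t" "t < lnorm N 2 (fourier N g)"
  shows "\<bar>FR N (\<lambda>x. g x + h x) - FR N g\<bar> \<le> (FR N h + FR N g) * t / (lnorm N 2 (fourier N g) - t)"
proof -
  define A B A' B' b where "A = lnorm N 1 (fourier N g)" and "B = lnorm N 2 (fourier N g)"
    and "A' = lnorm N 1 (fourier N (\<lambda>x. g x + h x))" and "B' = lnorm N 2 (fourier N (\<lambda>x. g x + h x))"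
    and "b = lnorm N 2 (fourier N h)"
  note defs = A_def B_def A'_def B'_def b_def
  have dA: "\<bar>A' - A\<bar> \<le> FR N h * b"
    unfolding defs lnorm_1_fourier[symmetric] fourier_add by (rule abs_lnorm_1_diff_le)
  have dB: "\<bar>B' - B\<bar> \<le> b"
    unfolding defs fourier_add by (rule abs_lnorm_2_diff_le)
  have b: "0 \<le> b" "b \<le> t" "t < B"
    using assms by (auto simp: defs lnorm_nonneg)
  have B': "0 < B - t" "B - t \<le> B'" "0 < B'" "0 < B"
    using b dB by auto
  have A: "A = FR N g * B"
    by (simp add: defs lnorm_1_fourier)
  have "FR N (\<lambda>x. g x + h x) - FR N g = A' / B' - FR N g"
    by (simp add: FR_def defs)
  \<comment> \<open>Substituting \<open>A = FR N g * B\<close> leaves the single denominator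
    \<open>B'\<close>, and the numerator contains only the two norm differences.\<close>
  also have "\<dots> = ((A' - A) + FR N g * (B - B')) / B'"
    using B' by (simp add: A field_simps)
  finally have "\<bar>FR N (\<lambda>x. g x + h x) - FR N g\<bar> = \<bar>(A' - A) + FR N g * (B - B')\<bar> / B'"
    using B' by simp
  also have "\<dots> \<le> (FR N h + FR N g) * t / (B - t)"
  \<comment> \<open>Numerator and denominator are bounded separately, the latter by
    \<open>B' \<ge> B - b \<ge> B - t > 0\<close>.\<close>
  proof (intro frac_le)
    have "\<bar>(A' - A) + FR N g * (B - B')\<bar> \<le> \<bar>A' - A\<bar> + FR N g * \<bar>B' - B\<bar>"
      using FR_nonneg[of N g] by (metis abs_triangle_ineq abs_mult abs_of_nonneg abs_minus_commute)
    also have "\<dots> \<le> FR N h * b + FR N g * b"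
      by (intro add_mono dA mult_left_mono dB FR_nonneg)
    also have "\<dots> \<le> (FR N h + FR N g) * t"
      unfolding distrib_right[symmetric] using b by (intro mult_left_mono) (auto simp: FR_nonneg)
    finally show "\<bar>(A' - A) + FR N g * (B - B')\<bar> \<le> (FR N h + FR N g) * t" .
    show "0 \<le> (FR N h + FR N g) * t"
      using b by (simp add: FR_nonneg)
  qed (use B' in auto)
  finally show ?thesis
    by (simp add: defs)
qed

section \<open>Exponential moments of Gaussian variables\<close>

lemma nn_integral_normal_density_exp_square:
  assumes "v > 0" "s < 1"
  shows "(\<integral>\<^sup>+x. ennreal (normal_density 0 (sqrt (v / 2)) x) * ennreal (exp (s * x\<^sup>2 / v)) \<partial>lborel)
    = ennreal (1 / sqrt (1 - s))"
proof -
  \<comment> \<open>The tilted density has exponent \<open>- (1 - s) * x\<^sup>2 / v\<close>, so it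
    is \<open>1 / sqrt (1 - s)\<close> times the centred Gaussian density of standard deviation
    \<open>\<tau>\<close>.\<close>
  define \<tau> where "\<tau> = sqrt (v / 2 / (1 - s))"
  have \<tau>: "\<tau> > 0" "\<tau>\<^sup>2 = v / 2 / (1 - s)"
    using assms by (simp_all add: \<tau>_def)
  have "normal_density 0 (sqrt (v / 2)) x * exp (s * x\<^sup>2 / v)
      = 1 / sqrt (1 - s) * normal_density 0 \<tau> x" for x
  proof -
    have "exp (- x\<^sup>2 / v) * exp (s * x\<^sup>2 / v) = exp (- x\<^sup>2 / (2 * \<tau>\<^sup>2))"
      using assms unfolding exp_add[symmetric] \<tau>(2) by (simp add: field_simps)
    moreover have "2 * pi * (v / 2) = (1 - s) * (2 * pi * \<tau>\<^sup>2)"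
      using assms unfolding \<tau>(2) by (simp add: divide_simps) (simp add: algebra_simps)?
    then have "1 / sqrt (2 * pi * (v / 2)) = 1 / sqrt (1 - s) * (1 / sqrt (2 * pi * \<tau>\<^sup>2))"
      by (simp only: real_sqrt_mult[of "1 - s"]) simp
    ultimately show ?thesis
      using assms by (simp add: normal_density_def)
  qed
  then have "(\<integral>\<^sup>+x. ennreal (normal_density 0 (sqrt (v / 2)) x) * ennreal (exp (s * x\<^sup>2 / v)) \<partial>lborel)
      = (\<integral>\<^sup>+x. ennreal (1 / sqrt (1 - s)) * ennreal (normal_density 0 \<tau> x) \<partial>lborel)"
    using assms by (simp add: ennreal_mult[symmetric] normal_density_nonneg)
  also have "\<dots> = ennreal (1 / sqrt (1 - s)) * (\<integral>\<^sup>+x. ennreal (normal_density 0 \<tau> x) \<partial>lborel)"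
    by (rule nn_integral_cmult) simp
  also have "(\<integral>\<^sup>+x. ennreal (normal_density 0 \<tau> x) \<partial>lborel) = 1"
    using \<tau> by (simp add: nn_integral_eq_integral normal_density_nonneg)
  finally show ?thesis
    by simp
qed

context prob_space
begin

text \<open>The finite product formula for independent families, taken over the index type
  \<open>bool\<close>. With values in \<open>ennreal\<close> no integrability has to be
  checked.\<close>

lemma indep_var_nn_integral:
  fixes X Y :: "'a \<Rightarrow> ennreal"
  assumes "indep_var borel X borel Y"
  shows "(\<integral>\<^sup>+\<omega>. X \<omega> * Y \<omega> \<partial>M) = (\<integral>\<^sup>+\<omega>. X \<omega> \<partial>M) * (\<integral>\<^sup>+\<omega>. Y \<omega> \<partial>M)"
proof -
  have "case_bool borel borel = (\<lambda>_. borel :: ennreal measure)"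
    by (auto simp: fun_eq_iff split: bool.split)
  with assms have "indep_vars (\<lambda>_. borel) (case_bool X Y) UNIV"
    by (simp add: indep_var_def)
  from indep_vars_nn_integral[OF _ this] show ?thesis
    by (simp add: UNIV_bool mult.commute)
qed

text \<open>The squared modulus splits into squares of the independent real and imaginary parts,
  each contributing \<open>1 / sqrt (1 - s)\<close>. The result is the moment generating function of
  an exponential variable of mean 1.\<close>

lemma circular_complex_gaussian_nn_integral_exp:
  assumes Z: "circular_complex_gaussian M v Z" and v: "v > 0" and s: "s < 1"
  shows "(\<integral>\<^sup>+\<omega>. ennreal (exp (s * (cmod (Z \<omega>))\<^sup>2 / v)) \<partial>M) = ennreal (1 / (1 - s))"
proof -
  define h where "h x = ennreal (exp (s * x\<^sup>2 / v))" for x :: real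
  have h: "h \<in> borel_measurable borel"
    unfolding h_def by measurable
  note Z = Z[unfolded circular_complex_gaussian_def]
  have *: "(\<integral>\<^sup>+\<omega>. h (X \<omega>) \<partial>M) = ennreal (1 / sqrt (1 - s))"
    if "distributed M lborel X (\<lambda>x. ennreal (normal_density 0 (sqrt (v / 2)) x))" for X
    using distributed_nn_integral[OF that, of h] h nn_integral_normal_density_exp_square[OF v s]
    by (simp add: h_def)
  have "(\<integral>\<^sup>+\<omega>. ennreal (exp (s * (cmod (Z \<omega>))\<^sup>2 / v)) \<partial>M) = (\<integral>\<^sup>+\<omega>. h (Re (Z \<omega>)) * h (Im (Z \<omega>)) \<partial>M)"
    by (simp add: h_def ennreal_mult[symmetric] exp_add[symmetric] cmod_power2 distrib_left add_divide_distrib)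
  also have "\<dots> = (\<integral>\<^sup>+\<omega>. h (Re (Z \<omega>)) \<partial>M) * (\<integral>\<^sup>+\<omega>. h (Im (Z \<omega>)) \<partial>M)"
    using indep_var_compose[OF conjunct1[OF Z] h h]
    by (intro indep_var_nn_integral) (simp add: comp_def)
  also have "\<dots> = ennreal (1 / (1 - s))"
    using Z s by (simp add: * ennreal_mult[symmetric])
  finally show ?thesis .
qed

lemma gaussian_noise_nn_integral_exp:
  assumes indep: "indep_vars (\<lambda>_. borel) n (ZN N)"
    and gauss: "\<And>x. x \<in> ZN N \<Longrightarrow> circular_complex_gaussian M (\<sigma>\<^sup>2) (n x)"
    and "\<sigma> > 0" "s < 1"
  shows "(\<integral>\<^sup>+\<omega>. ennreal (exp (s * (lnorm N 2 (\<lambda>x. n x \<omega>))\<^sup>2 / \<sigma>\<^sup>2)) \<partial>M) = ennreal ((1 / (1 - s)) ^ N)"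
proof -
  define X where "X x \<omega> = ennreal (exp (s * (cmod (n x \<omega>))\<^sup>2 / \<sigma>\<^sup>2))" for x \<omega>
  have "indep_vars (\<lambda>_. borel) X (ZN N)"
    unfolding X_def by (rule indep_vars_compose2[OF indep]) measurable
  then have "(\<integral>\<^sup>+\<omega>. (\<Prod>x\<in>ZN N. X x \<omega>) \<partial>M) = (\<Prod>x\<in>ZN N. \<integral>\<^sup>+\<omega>. X x \<omega> \<partial>M)"
    by (intro indep_vars_nn_integral) auto
  also have "\<dots> = (\<Prod>x\<in>ZN N. ennreal (1 / (1 - s)))"
    unfolding X_def using assms
    by (intro prod.cong refl circular_complex_gaussian_nn_integral_exp) auto
  also have "\<dots> = ennreal ((1 / (1 - s)) ^ N)"
    using \<open>s < 1\<close> by (simp add: ennreal_power)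
  also have "(\<lambda>\<omega>. \<Prod>x\<in>ZN N. X x \<omega>) = (\<lambda>\<omega>. ennreal (exp (s * (lnorm N 2 (\<lambda>x. n x \<omega>))\<^sup>2 / \<sigma>\<^sup>2)))"
    by (simp add: X_def prod_ennreal exp_sum[symmetric] lnorm_2 L2_set_def sum_nonneg
        sum_distrib_left sum_divide_distrib)
  finally show ?thesis .
qed

section \<open>Chernoff bound for the norm of the noise\<close>

lemma gaussian_noise_tail:
  assumes indep: "indep_vars (\<lambda>_. borel) n (ZN N)"
    and gauss: "\<And>x. x \<in> ZN N \<Longrightarrow> circular_complex_gaussian M (\<sigma>\<^sup>2) (n x)"
    and \<sigma>: "\<sigma> > 0" and \<gamma>: "0 < \<gamma>" "\<gamma> < 1" and N: "N > 0"
  shows "prob {\<omega> \<in> space M. noise_bound N \<sigma> \<gamma> < lnorm N 2 (\<lambda>x. n x \<omega>)} \<le> \<gamma>"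
proof -
  \<comment> \<open>This \<open>s\<close> is not the minimiser of the Chernoff bound, but it gives
    the simple values \<open>s * (a + b)\<^sup>2 = b * (a + b)\<close> and
    \<open>1 / (1 - s) = 1 + b / a\<close>.\<close>
  define a b s t where "a = sqrt (real N)" and "b = sqrt (ln (1 / \<gamma>))"
    and "s = b / (a + b)" and "t = noise_bound N \<sigma> \<gamma>"
  have ab: "a > 0" "b > 0" "a\<^sup>2 = real N" "b\<^sup>2 = ln (1 / \<gamma>)"
    using N \<gamma> by (auto simp: a_def b_def)
  have s: "0 < s" "s < 1" "1 / (1 - s) = 1 + b / a"
    using ab by (auto simp: s_def field_simps)
  have t: "0 < t" "t = \<sigma> * (a + b)"
    using ab \<sigma> by (auto simp: t_def noise_bound_def a_def[symmetric] b_def[symmetric])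
  define S where "S \<omega> = lnorm N 2 (\<lambda>x. n x \<omega>)" for \<omega>
  have n [measurable]: "x \<in> ZN N \<Longrightarrow> n x \<in> borel_measurable M" for x
    using indep by (auto simp: indep_vars_def)
  have S [measurable]: "S \<in> borel_measurable M"
    unfolding S_def lnorm_def by measurable
  \<comment> \<open>The event is put into the form "1 is at most a constant times a nonnegative
    function" that Markov's inequality expects.\<close>
  have "emeasure M {\<omega> \<in> space M. t < S \<omega>}
      \<le> emeasure M {\<omega> \<in> space M. 1 \<le> ennreal (exp (- (s * (a + b)\<^sup>2))) * ennreal (exp (s * (S \<omega>)\<^sup>2 / \<sigma>\<^sup>2))}"
  proof (intro emeasure_mono subsetI)
    fix \<omega> assume "\<omega> \<in> {\<omega> \<in> space M. t < S \<omega>}"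
    then have "\<omega> \<in> space M" "t\<^sup>2 \<le> (S \<omega>)\<^sup>2"
      using t by (auto intro: power_mono)
    then have "(a + b)\<^sup>2 \<le> (S \<omega>)\<^sup>2 / \<sigma>\<^sup>2"
      using \<sigma> by (simp add: t(2) power_mult_distrib pos_le_divide_eq mult.commute)
    then have "s * (a + b)\<^sup>2 \<le> s * (S \<omega>)\<^sup>2 / \<sigma>\<^sup>2"
      using mult_left_mono[OF _ less_imp_le[OF s(1)]] by fastforce
    with \<open>\<omega> \<in> space M\<close>
    show "\<omega> \<in> {\<omega> \<in> space M. 1 \<le> ennreal (exp (- (s * (a + b)\<^sup>2))) * ennreal (exp (s * (S \<omega>)\<^sup>2 / \<sigma>\<^sup>2))}"
      by (simp add: ennreal_mult[symmetric] exp_add[symmetric])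
  qed measurable
  also have "\<dots> \<le> ennreal (exp (- (s * (a + b)\<^sup>2)))
      * (\<integral>\<^sup>+\<omega>. ennreal (exp (s * (S \<omega>)\<^sup>2 / \<sigma>\<^sup>2)) * indicator (space M) \<omega> \<partial>M)"
    by (rule nn_integral_Markov_inequality) measurable
  also have "(\<integral>\<^sup>+\<omega>. ennreal (exp (s * (S \<omega>)\<^sup>2 / \<sigma>\<^sup>2)) * indicator (space M) \<omega> \<partial>M)
      = (\<integral>\<^sup>+\<omega>. ennreal (exp (s * (S \<omega>)\<^sup>2 / \<sigma>\<^sup>2)) \<partial>M)"
    by (rule nn_integral_cong) simp
  also have "\<dots> = ennreal ((1 + b / a) ^ N)"
    unfolding S_def s(3)[symmetric] using indep gauss \<sigma> s(2) by (rule gaussian_noise_nn_integral_exp)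
  also have "ennreal (exp (- (s * (a + b)\<^sup>2))) * ennreal ((1 + b / a) ^ N) \<le> ennreal \<gamma>"
  proof -
    have "(1 + b / a) ^ N \<le> exp (b / a) ^ N"
      using ab by (intro power_mono exp_ge_add_one_self) (auto intro: add_nonneg_nonneg)
    \<comment> \<open>As \<open>N\<close> is \<open>a\<^sup>2\<close>, the moment factor becomes
      \<open>exp (a * b)\<close>, which cancels the cross term of \<open>b * (a + b)\<close> and
      leaves \<open>exp (- b\<^sup>2)\<close>.\<close>
    also have "\<dots> = exp (a * b)"
      using ab by (simp add: exp_of_nat_mult[symmetric] ab(3)[symmetric] power2_eq_square)
    finally have "exp (- (s * (a + b)\<^sup>2)) * (1 + b / a) ^ N \<le> exp (- (b * (a + b))) * exp (a * b)"
      using ab by (simp add: s_def power2_eq_square)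
    also have "\<dots> = exp (- (b\<^sup>2))"
      by (simp add: exp_add[symmetric] power2_eq_square algebra_simps)
    also have "\<dots> = \<gamma>"
      using \<gamma> by (simp add: ab(4) ln_div)
    finally show ?thesis
      using ab by (simp add: ennreal_mult[symmetric] ennreal_leI add_nonneg_nonneg)
  qed
  finally show ?thesis
    using \<gamma> by (simp add: emeasure_eq_measure t_def S_def)
qed

end

text \<open>The last hypothesis makes the denominator positive. At or below
  \<open>noise_bound N \<sigma> \<gamma>\<close>, the norm of the transform of \<open>f\<close>
  would make the right-hand side at most 0.\<close>

theorem theorem1p33:
  fixes N :: nat and M :: "'a measure" and \<sigma> \<gamma> :: real
    and f :: "int \<Rightarrow> complex" and n :: "int \<Rightarrow> 'a \<Rightarrow> complex"
  assumes "N > 0"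
    and "prob_space M"
    and "\<sigma> > 0"
    and "0 < \<gamma>" and "\<gamma> < 1"
    and "prob_space.indep_vars M (\<lambda>_. borel) n (ZN N)"
    and "\<And>x. x \<in> ZN N \<Longrightarrow> circular_complex_gaussian M (\<sigma>\<^sup>2) (n x)"
    and "noise_bound N \<sigma> \<gamma> < lnorm N 2 (fourier N f)"
  shows "measure M {\<omega> \<in> space M.
           \<bar>FR N (\<lambda>x. f x + n x \<omega>) - FR N f\<bar>
             \<le> (FR N (\<lambda>x. n x \<omega>) + FR N f) * noise_bound N \<sigma> \<gamma>
                / (lnorm N 2 (fourier N f) - noise_bound N \<sigma> \<gamma>)}
         \<ge> 1 - \<gamma>"
proof -
  interpret prob_space M by fact
  have n [measurable]: "x \<in> ZN N \<Longrightarrow> n x \<in> borel_measurable M" for x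
    using assms(6) by (auto simp: indep_vars_def)
  have FR [measurable]: "(\<lambda>\<omega>. FR N (\<lambda>x. g x + n x \<omega>)) \<in> borel_measurable M" for g
    unfolding FR_def lnorm_def fourier_def by measurable
  have FR0 [measurable]: "(\<lambda>\<omega>. FR N (\<lambda>x. n x \<omega>)) \<in> borel_measurable M"
    \<comment> \<open>Pure noise is the zero signal plus noise.\<close>
    using FR[of "\<lambda>_. 0"] by simp
  have L [measurable]: "(\<lambda>\<omega>. lnorm N 2 (\<lambda>x. n x \<omega>)) \<in> borel_measurable M"
    unfolding lnorm_def by measurable
  \<comment> \<open>The exceptional set is phrased with \<open>n\<close> itself, where independence
    is available; \<open>plancherel\<close> transfers the bound off \<open>T\<close> to the
    transform.\<close>
  define T where "T = {\<omega> \<in> space M. noise_bound N \<sigma> \<gamma> < lnorm N 2 (\<lambda>x. n x \<omega>)}"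
  have T [measurable]: "T \<in> events"
    unfolding T_def by measurable
  have "prob T \<le> \<gamma>"
    unfolding T_def using assms by (intro gaussian_noise_tail)
  then have "1 - \<gamma> \<le> prob (space M - T)"
    by (simp add: prob_compl)
  also have "\<dots> \<le> prob {\<omega> \<in> space M.
           \<bar>FR N (\<lambda>x. f x + n x \<omega>) - FR N f\<bar>
             \<le> (FR N (\<lambda>x. n x \<omega>) + FR N f) * noise_bound N \<sigma> \<gamma>
                / (lnorm N 2 (fourier N f) - noise_bound N \<sigma> \<gamma>)}"
  proof (rule finite_measure_mono)
    show "space M - T \<subseteq> {\<omega> \<in> space M.
           \<bar>FR N (\<lambda>x. f x + n x \<omega>) - FR N f\<bar>
             \<le> (FR N (\<lambda>x. n x \<omega>) + FR N f) * noise_bound N \<sigma> \<gamma>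
                / (lnorm N 2 (fourier N f) - noise_bound N \<sigma> \<gamma>)}"
    proof
      fix \<omega> assume "\<omega> \<in> space M - T"
      moreover from this have "lnorm N 2 (fourier N (\<lambda>x. n x \<omega>)) \<le> noise_bound N \<sigma> \<gamma>"
        by (auto simp: T_def plancherel[OF assms(1)])
      ultimately show "\<omega> \<in> {\<omega> \<in> space M.
           \<bar>FR N (\<lambda>x. f x + n x \<omega>) - FR N f\<bar>
             \<le> (FR N (\<lambda>x. n x \<omega>) + FR N f) * noise_bound N \<sigma> \<gamma>
                / (lnorm N 2 (fourier N f) - noise_bound N \<sigma> \<gamma>)}"
        using FR_perturbation[OF _ assms(8)] by simp
    qed
  qed measurable
  finally show ?thesis .
qed

end
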